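(* Let $J\subseteq\mathcal L(X)$ be a nonempty upper set. Then \[\operatorname{Hilb}(\mathcal P(X,0,J),t)=t^{N-r}\sum_{\substack{A\subseteq X\\ \chi(A)=1}}t^{\,r-\operatorname{rank}(A)}\Big(\frac1t-1\Big)^{|A|-\operatorname{rank}(A)}.\]
   Context: Let $\mathbb{K}$ be a field of characteristic zero, $U$ a $\mathbb K$-vector space of dimension $r\ge1$, and $X=(x_1,\dots,x_N)$ a finite sequence in $U$ spanning $U$. Subsequences $A\subseteq X$ are taken with respect to indices (the sum runs over all $2^N$ index subsets); $X\setminus Y$ is the complementary subsequence. $\operatorname{rank}(A)$ is the dimension of the span of $A$; $\operatorname{clos}(A)=\{z\in X:\operatorname{rank}(A\cup z)=\operatorname{rank}(A)\}$; flats are $C$ with $\operatorname{clos}(C)=C$; $\mathcal L(X)$ is the lattice of flats. An upper set $J$ is closed under passing to larger flats; $\chi=\chi_J$ is its indicator function, extended by $\chi(A)=\chi(\operatorname{clos}(A))$. $p_u$ is the image of $u\in U$ in the symmetric algebra $\operatorname{Sym}(U)$, $p_Y=\prod_{z\in Y}p_z$. $\mathcal P(X,0,J)=\operatorname{span}\{p_Y: Y\subseteq X,\ \operatorname{clos}(X\setminus Y)\in J\}$, and $\operatorname{Hilb}(W,t)=\sum_i\dim(W_i)t^i$ with respect to the natural grading of $\operatorname{Sym}(U)$. *)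

theory Defs
  imports
    "HOL-Library.Poly_Mapping"
    "HOL-Library.Indicator_Function"
    "HOL-Computational_Algebra.Formal_Laurent_Series"
begin

section \<open>The symmetric algebra of a vector space\<close>

text \<open>
  The free commutative algebra over a field \<open>'k\<close> on the underlying set of the vector space is
  the polynomial ring \<^typ>\<open>('u \<Rightarrow>\<^sub>0 nat) \<Rightarrow>\<^sub>0 'k\<close>, with one variable for every vector. \<open>Sym(U)\<close> is its
  quotient by the ideal generated by the linear relations of \<open>U\<close>. As the scalar multiplication
  is a locale parameter, this quotient is not available as a type; a symmetric algebra
  of \<open>U\<close> is therefore any commutative algebra that is presented by these generators and
  relations.
\<close>

definition free_var :: "'u \<Rightarrow> (('u \<Rightarrow>\<^sub>0 nat) \<Rightarrow>\<^sub>0 'k::field)" where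
  "free_var u = Poly_Mapping.single (Poly_Mapping.single u 1) 1"

definition free_const :: "'k::field \<Rightarrow> (('u \<Rightarrow>\<^sub>0 nat) \<Rightarrow>\<^sub>0 'k)" where
  "free_const c = Poly_Mapping.single 0 c"

text \<open>The span in the ring, regarded as a module over itself, is the generated ideal.\<close>

definition linear_relations_ideal ::
    "('k::field \<Rightarrow> 'u::ab_group_add \<Rightarrow> 'u) \<Rightarrow> (('u \<Rightarrow>\<^sub>0 nat) \<Rightarrow>\<^sub>0 'k) set" where
  "linear_relations_ideal scale = module.span (*)
     ({free_var (u + v) - free_var u - free_var v | u v. True} \<union>
      {free_var (scale c u) - free_const c * free_var u | c u. True})"

definition free_eval ::
    "('k::field \<Rightarrow> 's::comm_ring_1 \<Rightarrow> 's) \<Rightarrow> ('u \<Rightarrow> 's) \<Rightarrow> (('u \<Rightarrow>\<^sub>0 nat) \<Rightarrow>\<^sub>0 'k) \<Rightarrow> 's" where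
  "free_eval scale p f =
     (\<Sum>m\<in>Poly_Mapping.keys f. scale (Poly_Mapping.lookup f m)
        (\<Prod>u\<in>Poly_Mapping.keys m. p u ^ Poly_Mapping.lookup m u))"

locale commutative_algebra = vector_space scale
  for scale :: "'k::field \<Rightarrow> 's::comm_ring_1 \<Rightarrow> 's" +
  assumes scale_mult_left: "scale c (x * y) = scale c x * y"

locale symmetric_algebra = U: vector_space scaleU + S: commutative_algebra scaleS
  for scaleU :: "'k::field \<Rightarrow> 'u::ab_group_add \<Rightarrow> 'u"
    and scaleS :: "'k \<Rightarrow> 's::comm_ring_1 \<Rightarrow> 's" +
  fixes p :: "'u \<Rightarrow> 's"
  assumes generated: "range (free_eval scaleS p) = UNIV"
    and relations: "{f. free_eval scaleS p f = 0} = linear_relations_ideal scaleU"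

text \<open>
  The notion is the intended one: a symmetric algebra has the universal property, and
  the polynomial ring on the elements of a basis \<open>b\<close> of \<open>U\<close> is one.
\<close>

definition power_product :: "('u \<Rightarrow> 's::comm_ring_1) \<Rightarrow> ('u \<Rightarrow>\<^sub>0 nat) \<Rightarrow> 's" where
  "power_product p m = (\<Prod>u\<in>Poly_Mapping.keys m. p u ^ Poly_Mapping.lookup m u)"

lemma power_product_superset:
  assumes "finite A" "Poly_Mapping.keys m \<subseteq> A"
  shows "power_product p m = (\<Prod>u\<in>A. p u ^ Poly_Mapping.lookup m u)"
  unfolding power_product_def
  by (rule prod.mono_neutral_left) (use assms in \<open>auto simp: in_keys_iff\<close>)

lemma power_product_add: "power_product p (m + n) = power_product p m * power_product p n"
proof -
  let ?A = "Poly_Mapping.keys m \<union> Poly_Mapping.keys n"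
  have "power_product p (m + n) = (\<Prod>u\<in>?A. p u ^ Poly_Mapping.lookup (m + n) u)"
    by (rule power_product_superset) (simp_all add: Poly_Mapping.keys_add)
  also have "\<dots> = (\<Prod>u\<in>?A. p u ^ Poly_Mapping.lookup m u) * (\<Prod>u\<in>?A. p u ^ Poly_Mapping.lookup n u)"
    by (simp add: lookup_add power_add prod.distrib)
  also have "\<dots> = power_product p m * power_product p n"
    by (simp add: power_product_superset[of ?A])
  finally show ?thesis .
qed

lemma power_product_zero [simp]: "power_product p 0 = 1"
  by (simp add: power_product_def)

lemma power_product_single [simp]: "power_product p (Poly_Mapping.single u n) = p u ^ n"
  by (cases "n = 0") (auto simp: power_product_def)

lemma poly_mapping_induct_single [case_names single add]:
  assumes "\<And>m c. Q (Poly_Mapping.single m c)" and "\<And>f g. Q f \<Longrightarrow> Q g \<Longrightarrow> Q (f + g)"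
  shows "Q (f :: 'm \<Rightarrow>\<^sub>0 'c::comm_monoid_add)"
proof (induction f rule: update_induct)
  case const
  show ?case using assms(1)[of undefined 0] by simp
next
  case (update f a c)
  have "Poly_Mapping.update a c f = f + Poly_Mapping.single a c"
    using update(1) by (intro poly_mapping_eqI) (auto simp: lookup_update lookup_add lookup_single in_keys_iff when_def)
  then show ?case using assms update(3) by metis
qed

context commutative_algebra
begin

lemma scale_mult_right: "scale c (x * y) = x * scale c y"
  by (metis mult.commute scale_mult_left)

lemma free_eval_superset:
  assumes "finite A" "Poly_Mapping.keys f \<subseteq> A"
  shows "free_eval scale p f = (\<Sum>m\<in>A. scale (Poly_Mapping.lookup f m) (power_product p m))"
  unfolding free_eval_def power_product_def[symmetric]
  by (rule sum.mono_neutral_left) (use assms in \<open>auto simp: in_keys_iff\<close>)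

lemma free_eval_add: "free_eval scale p (f + g) = free_eval scale p f + free_eval scale p g"
proof -
  let ?A = "Poly_Mapping.keys f \<union> Poly_Mapping.keys g"
  show ?thesis
    using free_eval_superset[of ?A "f + g" p] free_eval_superset[of ?A f p] free_eval_superset[of ?A g p]
    by (simp add: Poly_Mapping.keys_add lookup_add scale_left_distrib sum.distrib)
qed

lemma free_eval_single:
  "free_eval scale p (Poly_Mapping.single m c) = scale c (power_product p m)"
  using free_eval_superset[of "{m}" "Poly_Mapping.single m c" p] by simp

lemma free_eval_zero [simp]: "free_eval scale p 0 = 0"
  by (simp add: free_eval_def)

lemma free_eval_one [simp]: "free_eval scale p 1 = 1"
  using free_eval_single[of p 0 1] by simp

lemma free_eval_minus: "free_eval scale p (f - g) = free_eval scale p f - free_eval scale p g"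
  using free_eval_add[of p "f - g" g] by (simp add: algebra_simps)

lemma free_eval_mult: "free_eval scale p (f * g) = free_eval scale p f * free_eval scale p g"
proof (induction f rule: poly_mapping_induct_single)
  case (single m c)
  show ?case
  proof (induction g rule: poly_mapping_induct_single)
    case (single n d)
    show ?case
      by (simp add: mult_single free_eval_single power_product_add scale_mult_left[symmetric]
          scale_mult_right[symmetric])
  qed (simp add: free_eval_add algebra_simps)
qed (simp add: free_eval_add algebra_simps)

lemma free_eval_const: "free_eval scale p (free_const c * f) = scale c (free_eval scale p f)"
  using scale_mult_left[of c 1 "free_eval scale p f"]
  by (simp add: free_const_def free_eval_mult free_eval_single)

lemma free_eval_var [simp]: "free_eval scale p (free_var u) = p u"
  by (simp add: free_var_def free_eval_single)

lemma free_eval_relation: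
  fixes scaleU :: "'k \<Rightarrow> 'u::ab_group_add \<Rightarrow> 'u"
  assumes "Vector_Spaces.linear scaleU scale g" and "f \<in> linear_relations_ideal scaleU"
  shows "free_eval scale g f = 0"
proof -
  interpret g: Vector_Spaces.linear scaleU scale g by fact
  interpret F: module "(*) :: (('u \<Rightarrow>\<^sub>0 nat) \<Rightarrow>\<^sub>0 'k) \<Rightarrow> _"
    by unfold_locales (simp_all add: algebra_simps)
  have "F.subspace {f. free_eval scale g f = 0}"
    by (auto simp: F.subspace_def free_eval_add free_eval_mult)
  then have "F.span R \<subseteq> {f. free_eval scale g f = 0}"
    if "\<And>f. f \<in> R \<Longrightarrow> free_eval scale g f = 0" for R
    using that by (intro F.span_minimal) auto
  moreover have "free_eval scale g f = 0"
    if "f \<in> {free_var (u + v) - free_var u - free_var v | u v. True} \<union>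
      {free_var (scaleU c u) - free_const c * free_var u | c u. True}" for f
    using that by (auto simp: free_eval_minus free_eval_const g.add g.scale)
  ultimately show ?thesis
    using assms(2) unfolding linear_relations_ideal_def by blast
qed

end

context symmetric_algebra
begin

lemma free_eval_eq_iff:
  "free_eval scaleS p f = free_eval scaleS p g \<longleftrightarrow> f - g \<in> linear_relations_ideal scaleU"
  by (subst relations[symmetric]) (simp add: S.free_eval_minus)

lemma linear_p: "Vector_Spaces.linear scaleU scaleS p"
proof -
  interpret F: module "(*) :: (('u \<Rightarrow>\<^sub>0 nat) \<Rightarrow>\<^sub>0 'k) \<Rightarrow> _"
    by unfold_locales (simp_all add: algebra_simps)
  have "p (u + v) = p u + p v" for u v
  proof -
    have "free_var (u + v) - (free_var u + free_var v) \<in> linear_relations_ideal scaleU"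
      unfolding linear_relations_ideal_def
      by (rule F.span_base) (force simp: algebra_simps)
    then show ?thesis
      by (subst (asm) free_eval_eq_iff[symmetric]) (simp add: S.free_eval_add)
  qed
  moreover have "p (scaleU c u) = scaleS c (p u)" for c u
  proof -
    have "free_var (scaleU c u) - free_const c * free_var u \<in> linear_relations_ideal scaleU"
      unfolding linear_relations_ideal_def by (rule F.span_base) blast
    then show ?thesis
      by (subst (asm) free_eval_eq_iff[symmetric]) (simp add: S.free_eval_const)
  qed
  ultimately show ?thesis
    by unfold_locales
qed

theorem universal_property:
  fixes scaleA :: "'k \<Rightarrow> 'd::comm_ring_1 \<Rightarrow> 'd"
  assumes A: "commutative_algebra scaleA" and g: "Vector_Spaces.linear scaleU scaleA g"
  shows "\<exists>!h. Vector_Spaces.linear scaleS scaleA h \<and> h 1 = 1 \<and> (\<forall>x y. h (x * y) = h x * h y) \<and> (\<forall>u. h (p u) = g u)"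
proof -
  interpret A: commutative_algebra scaleA by fact
  define h where "h x = free_eval scaleA g (SOME f. free_eval scaleS p f = x)" for x
  have h: "h (free_eval scaleS p f) = free_eval scaleA g f" for f
  proof -
    let ?f = "SOME f'. free_eval scaleS p f' = free_eval scaleS p f"
    have "free_eval scaleS p ?f = free_eval scaleS p f"
      by (rule someI[of _ f]) simp
    then have "free_eval scaleA g (?f - f) = 0"
      by (intro A.free_eval_relation[OF g]) (simp add: free_eval_eq_iff)
    then show ?thesis
      by (simp add: h_def A.free_eval_minus)
  qed
  have ex: "\<exists>f. x = free_eval scaleS p f" for x
    using generated by blast
  have 1: "h (x + y) = h x + h y" for x y
    using ex[of x] ex[of y] h by (metis S.free_eval_add A.free_eval_add)
  have 2: "h (x * y) = h x * h y" for x y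
    using ex[of x] ex[of y] h by (metis S.free_eval_mult A.free_eval_mult)
  have 3: "h (scaleS c x) = scaleA c (h x)" for c x
    using ex[of x] h by (metis S.free_eval_const A.free_eval_const)
  have 4: "h 1 = 1" using h[of 1] by simp
  have 5: "h (p u) = g u" for u using h[of "free_var u"] by simp
  have lin: "Vector_Spaces.linear scaleS scaleA h"
    by unfold_locales (simp_all add: 1 3)
  show ?thesis
  proof (rule ex1I[of _ h])
    show "Vector_Spaces.linear scaleS scaleA h \<and> h 1 = 1 \<and> (\<forall>x y. h (x * y) = h x * h y) \<and> (\<forall>u. h (p u) = g u)"
      using lin 2 4 5 by blast
  next
    fix k
    assume k: "Vector_Spaces.linear scaleS scaleA k \<and> k 1 = 1 \<and> (\<forall>x y. k (x * y) = k x * k y) \<and> (\<forall>u. k (p u) = g u)"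
    interpret k: Vector_Spaces.linear scaleS scaleA k using k by blast
    have pow: "k (x ^ n) = k x ^ n" for x n
      by (induction n) (use k in auto)
    have prod: "k (prod q B) = (\<Prod>b\<in>B. k (q b))" for q :: "'u \<Rightarrow> 's" and B
      by (induction B rule: infinite_finite_induct) (use k in auto)
    have "k (free_eval scaleS p f) = free_eval scaleA g f" for f
      unfolding free_eval_def by (simp add: k.sum k.scale prod pow k)
    then show "k = h"
      using ex h by (metis ext)
  qed
qed

end

theorem polynomial_ring_symmetric_algebra:
  fixes scaleU :: "'k::field \<Rightarrow> 'u::ab_group_add \<Rightarrow> 'u" and b :: "'n \<Rightarrow> 'u"
  assumes "vector_space scaleU" and "inj b"
    and "\<not> module.dependent scaleU (range b)" and "module.span scaleU (range b) = UNIV"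
  shows "symmetric_algebra scaleU (\<lambda>c f. free_const c * f :: ('n \<Rightarrow>\<^sub>0 nat) \<Rightarrow>\<^sub>0 'k)
    (\<lambda>u. \<Sum>i | module.representation scaleU (range b) u (b i) \<noteq> 0.
       free_const (module.representation scaleU (range b) u (b i)) * free_var i)"
    (is "symmetric_algebra scaleU ?scale ?p")
proof -
  interpret U: vector_space scaleU by fact
  have const: "free_const (c + d) = free_const c + (free_const d :: ('x \<Rightarrow>\<^sub>0 nat) \<Rightarrow>\<^sub>0 'k)"
    "free_const (c * d) = free_const c * (free_const d :: ('x \<Rightarrow>\<^sub>0 nat) \<Rightarrow>\<^sub>0 'k)"
    "free_const 1 = (1 :: ('x \<Rightarrow>\<^sub>0 nat) \<Rightarrow>\<^sub>0 'k)" "free_const 0 = (0 :: ('x \<Rightarrow>\<^sub>0 nat) \<Rightarrow>\<^sub>0 'k)"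
    for c d
    by (simp_all add: free_const_def single_add mult_single)
  interpret S: commutative_algebra ?scale
    by unfold_locales (simp_all add: const algebra_simps)
  interpret V: commutative_algebra "\<lambda>c f. free_const c * f :: ('u \<Rightarrow>\<^sub>0 nat) \<Rightarrow>\<^sub>0 'k"
    by unfold_locales (simp_all add: const algebra_simps)
  interpret F: module "(*) :: (('u \<Rightarrow>\<^sub>0 nat) \<Rightarrow>\<^sub>0 'k) \<Rightarrow> _"
    by unfold_locales (simp_all add: algebra_simps)
  define I where "I = linear_relations_ideal scaleU"
  define R where "R = U.representation (range b)"
  have p: "?p u = (\<Sum>i\<in>A. ?scale (R u (b i)) (free_var i))"
    if "finite A" "{i. R u (b i) \<noteq> 0} \<subseteq> A" for u A
    unfolding R_def
    by (rule sum.mono_neutral_left) (use that in \<open>auto simp: R_def const\<close>)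
  have fin: "finite {i. R u (b i) \<noteq> 0}" for u
  proof -
    have "finite (b -` {v. R u v \<noteq> 0})"
      unfolding R_def by (rule finite_vimageI[OF U.finite_representation assms(2)])
    then show ?thesis by (simp add: vimage_def)
  qed
  have R_add: "R (u + v) w = R u w + R v w" and R_scale: "R (scaleU c u) w = c * R u w" for u v w c
    unfolding R_def using assms(3,4) by (simp_all add: U.representation_add U.representation_scale)
  have lin: "Vector_Spaces.linear scaleU ?scale ?p"
  proof -
    have "?p (u + v) = ?p u + ?p v" for u v
    proof -
      let ?A = "{i. R u (b i) \<noteq> 0} \<union> {i. R v (b i) \<noteq> 0}"
      have "{i. R (u + v) (b i) \<noteq> 0} \<subseteq> ?A" by (auto simp: R_add)
      then show ?thesis
        using p[of ?A u] p[of ?A v] p[of ?A "u + v"] fin[of u] fin[of v]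
        by (simp add: R_add const sum.distrib algebra_simps)
    qed
    moreover have "?p (scaleU c u) = ?scale c (?p u)" for c u
    proof -
      let ?A = "{i. R u (b i) \<noteq> 0}"
      have "{i. R (scaleU c u) (b i) \<noteq> 0} \<subseteq> ?A" by (auto simp: R_scale)
      then show ?thesis
        unfolding p[OF fin[of u] subset_refl] p[OF fin[of u] \<open>_ \<subseteq> ?A\<close>]
        by (simp only: R_scale const sum_distrib_left mult.assoc)
    qed
    ultimately show ?thesis
      by unfold_locales
  qed
  have p_b: "?p (b i) = free_var i" for i
  proof -
    have *: "R (b i) (b j) = (if j = i then 1 else 0)" for j
      unfolding R_def using U.representation_basis[OF assms(3), of "b i"] inj_eq[OF assms(2)] by auto
    show ?thesis using p[of "{i}" "b i"] by (auto simp: * const)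
  qed
  define \<psi> where "\<psi> = free_eval (\<lambda>c f. free_const c * f :: ('u \<Rightarrow>\<^sub>0 nat) \<Rightarrow>\<^sub>0 'k) (\<lambda>i. free_var (b i))"
  have I_add: "f + g \<in> I" if "f \<in> I" "g \<in> I" for f g
    using that F.span_add unfolding I_def linear_relations_ideal_def by blast
  have I_mult: "f * g \<in> I" if "g \<in> I" for f g
    using that F.span_scale unfolding I_def linear_relations_ideal_def by blast
  have I_base: "free_var (u + v) - free_var u - free_var v \<in> I"
    "free_var (scaleU c u) - free_const c * free_var u \<in> I" for u v c
    unfolding I_def linear_relations_ideal_def by (rule F.span_base, blast)+
  have I_neg: "- f \<in> I" if "f \<in> I" for f
    using I_mult[OF that, of "-1"] by simp
  have I_zero: "0 \<in> I"
    using F.span_zero unfolding I_def linear_relations_ideal_def by blast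
  have \<psi>_p: "\<psi> (?p u) - free_var u \<in> I" for u
  proof -
    have sum_I: "(\<Sum>i\<in>A. free_const (c i) * free_var (b i)) - free_var (\<Sum>i\<in>A. scaleU (c i) (b i)) \<in> I"
      if "finite A" for A and c :: "'n \<Rightarrow> 'k"
      using that
    proof (induction A rule: finite_induct)
      case empty
      show ?case using I_neg[OF I_base(2)[of 0 0]] by (simp add: const)
    next
      case (insert i A)
      let ?s = "\<Sum>i\<in>A. scaleU (c i) (b i)"
      let ?x = "scaleU (c i) (b i)"
      have "((\<Sum>i\<in>A. free_const (c i) * free_var (b i)) - free_var ?s)
          + (- (free_var (?x + ?s) - free_var ?x - free_var ?s)
          + - (free_var ?x - free_const (c i) * free_var (b i))) \<in> I"
        by (intro I_add I_neg insert.IH I_base)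
      then show ?case using insert.hyps by (simp add: algebra_simps)
    qed
    let ?A = "{i. R u (b i) \<noteq> 0}"
    have \<psi>_sum: "\<psi> (sum q A) = (\<Sum>i\<in>A. \<psi> (q i))" for q :: "'n \<Rightarrow> _" and A
      unfolding \<psi>_def by (induction A rule: infinite_finite_induct) (simp_all add: V.free_eval_add)
    have "\<psi> (?p u) = (\<Sum>i\<in>?A. free_const (R u (b i)) * free_var (b i))"
      using p[of ?A u] fin[of u] \<psi>_sum by (simp add: \<psi>_def V.free_eval_const)
    moreover have "(\<Sum>i\<in>?A. scaleU (R u (b i)) (b i)) = u"
    proof -
      have "(\<Sum>i\<in>?A. scaleU (R u (b i)) (b i)) = (\<Sum>v\<in>b ` ?A. scaleU (R u v) v)"
        by (subst sum.reindex) (use assms(2) in \<open>auto intro: inj_on_subset\<close>)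
      also have "b ` ?A = {v. R u v \<noteq> 0}"
        unfolding R_def using U.representation_ne_zero[of "range b" u] by auto
      also have "(\<Sum>v | R u v \<noteq> 0. scaleU (R u v) v) = u"
        unfolding R_def using U.sum_nonzero_representation_eq[OF assms(3), of u] assms(4) by simp
      finally show ?thesis .
    qed
    ultimately show ?thesis
      using sum_I[OF fin[of u], of "\<lambda>i. R u (b i)"] by simp
  qed
  have I_mult2: "x * y - x' * y' \<in> I" if "x - x' \<in> I" "y - y' \<in> I" for x y x' y'
    using I_add[OF I_mult[OF that(1), of y] I_mult[OF that(2), of x']] by (simp add: algebra_simps)
  have \<psi>_mult: "\<psi> (f * g) = \<psi> f * \<psi> g" for f g by (simp add: \<psi>_def V.free_eval_mult)
  define q where "q = ?p"
  define ev where "ev = free_eval ?scale q"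
  have ev_add: "ev (f + g) = ev f + ev g" and ev_mult: "ev (f * g) = ev f * ev g"
    and ev_const: "ev (free_const c * f) = free_const c * ev f" and ev_var: "ev (free_var u) = q u"
    and ev_single: "ev (Poly_Mapping.single m c) = free_const c * power_product q m"
    and ev_one: "ev 1 = 1" for f g c u m
    unfolding ev_def
    by (rule S.free_eval_add S.free_eval_mult S.free_eval_const S.free_eval_var S.free_eval_single
        S.free_eval_one)+
  have \<psi>_add: "\<psi> (f + g) = \<psi> f + \<psi> g" and \<psi>_const: "\<psi> (free_const c * f) = free_const c * \<psi> f"
    and \<psi>_one: "\<psi> 1 = 1" for f g c
    unfolding \<psi>_def by (rule V.free_eval_add V.free_eval_const V.free_eval_one)+
  have \<psi>_p': "\<psi> (q u) - free_var u \<in> I" for u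
    unfolding q_def by (rule \<psi>_p)
  have q_b: "q (b i) = free_var i" for i
    unfolding q_def by (rule p_b)
  have \<psi>_ev: "\<psi> (ev f) - f \<in> I" for f
  proof (induction f rule: poly_mapping_induct_single)
    case (add f g)
    show ?case
      using I_add[OF add] by (simp add: ev_add \<psi>_add algebra_simps)
  next
    case (single m c)
    have "\<psi> (power_product q m) - Poly_Mapping.single m 1 \<in> I"
    proof (induction m rule: poly_mapping_induct_single)
      case (add m n)
      show ?case using I_mult2[OF add] by (simp add: power_product_add \<psi>_mult mult_single)
    next
      case (single u n)
      show ?case
      proof (induction n)
        case 0
        show ?case using I_zero by (simp add: \<psi>_one)
      next
        case (Suc n)
        show ?case using I_mult2[OF \<psi>_p'[of u] Suc]
          by (simp add: \<psi>_mult mult_single free_var_def single_add[symmetric])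
      qed
    qed
    from I_mult[OF this, of "free_const c"]
    show ?case
      by (simp add: ev_single \<psi>_const right_diff_distrib)
        (simp add: free_const_def mult_single)
  qed
  show ?thesis
  proof unfold_locales
    show "range (free_eval ?scale ?p) = UNIV"
    proof -
      have "\<exists>g. f = ev g" for f
      proof (induction f rule: poly_mapping_induct_single)
        case (add f g)
        then show ?case by (metis ev_add)
      next
        case (single m c)
        have "\<exists>g. (Poly_Mapping.single m 1 :: ('n \<Rightarrow>\<^sub>0 nat) \<Rightarrow>\<^sub>0 'k) = ev g"
        proof (induction m rule: poly_mapping_induct_single)
          case (add m n)
          then show ?case by (metis ev_mult mult_single mult_1)
        next
          case (single i n)
          have "(Poly_Mapping.single (Poly_Mapping.single i n) 1 :: ('n \<Rightarrow>\<^sub>0 nat) \<Rightarrow>\<^sub>0 'k)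
              = ev (free_var (b i) ^ n)"
          proof (induction n)
            case (Suc n)
            have "ev (free_var (b i) ^ Suc n)
                = free_var i * Poly_Mapping.single (Poly_Mapping.single i n) 1"
              by (simp only: power_Suc ev_mult Suc[symmetric] ev_var q_b)
            then show ?case by (simp add: free_var_def mult_single single_add[symmetric])
          qed (simp add: ev_one)
          then show ?case by blast
        qed
        then obtain g where "(Poly_Mapping.single m 1 :: ('n \<Rightarrow>\<^sub>0 nat) \<Rightarrow>\<^sub>0 'k) = ev g"
          by blast
        then have "ev (free_const c * g) = Poly_Mapping.single m c"
          by (simp only: ev_const) (simp add: free_const_def mult_single flip: \<open>_ = ev g\<close>)
        then show ?case by metis
      qed
      then show ?thesis unfolding ev_def q_def by blast
    qed
    show "{f. free_eval ?scale ?p f = 0} = linear_relations_ideal scaleU"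
    proof safe
      fix f assume "free_eval ?scale ?p f = 0"
      with \<psi>_ev[of f] have "- f \<in> I" by (simp add: ev_def q_def \<psi>_def)
      from I_neg[OF this] show "f \<in> linear_relations_ideal scaleU" by (simp add: I_def)
    qed (rule S.free_eval_relation[OF lin])
  qed
qed

definition sym_graded_part ::
    "('k::field \<Rightarrow> 's::comm_ring_1 \<Rightarrow> 's) \<Rightarrow> ('u \<Rightarrow> 's) \<Rightarrow> nat \<Rightarrow> 's set" where
  "sym_graded_part scaleS p i = module.span scaleS {prod_list (map p us) | us. length us = i}"

text \<open>
  The series is taken among the formal Laurent series over the rationals because the formula
  it is compared with contains \<open>1/t\<close>.
\<close>

definition hilbert_series ::
    "('k::field \<Rightarrow> 's::comm_ring_1 \<Rightarrow> 's) \<Rightarrow> ('u \<Rightarrow> 's) \<Rightarrow> 's set \<Rightarrow> rat fls" where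
  "hilbert_series scaleS p W =
     fps_to_fls (Abs_fps (\<lambda>i. of_nat (vector_space.dim scaleS (W \<inter> sym_graded_part scaleS p i))))"


section \<open>Flats and the space \<open>\<P>(X,0,J)\<close>\<close>

text \<open>
  A subsequence of the list \<open>X\<close> is represented by its set of positions \<open>A \<subseteq> {..<length X}\<close>.
\<close>

definition seq_rank :: "('k::field \<Rightarrow> 'u::ab_group_add \<Rightarrow> 'u) \<Rightarrow> 'u list \<Rightarrow> nat set \<Rightarrow> nat" where
  "seq_rank scale X A = vector_space.dim scale (module.span scale ((\<lambda>i. X ! i) ` A))"

definition seq_clos :: "('k::field \<Rightarrow> 'u::ab_group_add \<Rightarrow> 'u) \<Rightarrow> 'u list \<Rightarrow> nat set \<Rightarrow> nat set" where
  "seq_clos scale X A = {z. z < length X \<and> seq_rank scale X (insert z A) = seq_rank scale X A}"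

definition flats :: "('k::field \<Rightarrow> 'u::ab_group_add \<Rightarrow> 'u) \<Rightarrow> 'u list \<Rightarrow> nat set set" where
  "flats scale X = {C. C \<subseteq> {..<length X} \<and> seq_clos scale X C = C}"

definition upper_set :: "('k::field \<Rightarrow> 'u::ab_group_add \<Rightarrow> 'u) \<Rightarrow> 'u list \<Rightarrow> nat set set \<Rightarrow> bool" where
  "upper_set scale X J \<longleftrightarrow>
     J \<subseteq> flats scale X \<and> (\<forall>C\<in>J. \<forall>D\<in>flats scale X. C \<subseteq> D \<longrightarrow> D \<in> J)"

definition chi ::
    "('k::field \<Rightarrow> 'u::ab_group_add \<Rightarrow> 'u) \<Rightarrow> 'u list \<Rightarrow> nat set set \<Rightarrow> nat set \<Rightarrow> nat" where
  "chi scale X J A = indicator J (seq_clos scale X A)"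

definition p_prod :: "('u \<Rightarrow> 's::comm_ring_1) \<Rightarrow> 'u list \<Rightarrow> nat set \<Rightarrow> 's" where
  "p_prod p X Y = (\<Prod>i\<in>Y. p (X ! i))"

definition P_space ::
    "('k::field \<Rightarrow> 'u::ab_group_add \<Rightarrow> 'u) \<Rightarrow> ('k \<Rightarrow> 's::comm_ring_1 \<Rightarrow> 's) \<Rightarrow> ('u \<Rightarrow> 's) \<Rightarrow>
     'u list \<Rightarrow> nat set set \<Rightarrow> 's set" where
  "P_space scaleU scaleS p X J = module.span scaleS
     {p_prod p X Y | Y. Y \<subseteq> {..<length X} \<and> seq_clos scaleU X ({..<length X} - Y) \<in> J}"

end

theory Submission
  imports Defs
begin

text \<open>
  Call a set \<open>B\<close> of positions closed if every \<open>e\<close> with \<open>x\<^sub>e\<close> in the span of the \<open>x\<^sub>b\<close>, \<open>b \<in> B\<close>,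
  \<open>e < b\<close>, belongs to \<open>B\<close>. The products of the \<open>x\<^sub>i\<close> with \<open>i \<notin> B\<close>, for \<open>B\<close> closed with
  \<open>\<chi>(B) = 1\<close>, form a homogeneous basis of \<open>\<P>(X,0,J)\<close>. They span because a linear dependency
  \<open>x\<^sub>e = \<Sum> c\<^sub>a x\<^sub>a\<close> violating closedness rewrites the product as a combination of products
  belonging to sets with the same span and smaller index sum. They are independent by deletion
  and contraction of the last vector, carried out on the polynomial functions on the dual of \<open>U\<close>.
  Finally every \<open>A\<close> lies in exactly one interval \<open>[L, B]\<close> with \<open>B\<close> closed and \<open>L\<close> its
  lexicographic basis, and the terms of the rank generating function over this interval add
  up to \<open>t\<close> to the power \<open>N - |B|\<close>.
\<close>

section \<open>Binomial sums, functionals and finite families of vectors\<close>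

lemma sum_Pow_power_card:
  assumes "finite E"
  shows "(\<Sum>S\<in>Pow E. q ^ card S) = (1 + q :: 'a::comm_ring_1) ^ card E"
  using prod_add[OF assms, of "\<lambda>_. q" "\<lambda>_. 1"] by (simp add: add.commute)

context vector_space
begin

lemma vector_space_pair_functionals: "vector_space_pair scale ((*) :: 'a \<Rightarrow> 'a \<Rightarrow> 'a)"
proof -
  interpret K: vector_space "(*) :: 'a \<Rightarrow> 'a \<Rightarrow> 'a"
    by unfold_locales (simp_all add: algebra_simps)
  show ?thesis ..
qed

text \<open>A functional can be prescribed on an independent set: \<open>1\<close> at
  \<open>v\<close> and \<open>0\<close> on a maximal independent subset of \<open>W\<close>.\<close>

lemma separating_functional:
  assumes "v \<notin> span W"
  obtains \<phi> where "Vector_Spaces.linear scale (*) \<phi>" "\<forall>w\<in>W. \<phi> w = 0" "\<phi> v = 1"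
proof -
  interpret P: vector_space_pair scale "(*) :: 'a \<Rightarrow> 'a \<Rightarrow> 'a"
    by (rule vector_space_pair_functionals)
  obtain B where B: "B \<subseteq> W" "independent B" "W \<subseteq> span B"
    using maximal_independent_subset[of W] by blast
  have v: "v \<notin> span B"
    using assms span_mono[OF B(1)] by blast
  have "independent (insert v B)"
    using v B(2) by (metis independent_insertI)
  from P.linear_independent_extend[OF this, of "\<lambda>u. if u = v then 1 else 0"]
  obtain \<phi> where \<phi>: "Vector_Spaces.linear scale (*) \<phi>"
    and ext: "\<forall>u\<in>insert v B. \<phi> u = (if u = v then 1 else 0)"
    by blast
  interpret \<phi>: Vector_Spaces.linear scale "(*)" \<phi> by fact
  have B0: "\<phi> b = 0" if "b \<in> B" for b
    using ext that v span_base by fastforce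
  have "\<phi> w = 0" if "w \<in> W" for w
  proof -
    have "w \<in> span B" using that B(3) by blast
    then show ?thesis
      by (induction rule: span_induct_alt) (simp_all add: \<phi>.add \<phi>.scale B0)
  qed
  with \<phi> ext show thesis by (intro that[of \<phi>]) auto
qed

text \<open>Coefficients are indexed by \<open>A\<close>, not by vectors, so that repeated vectors
  cause no trouble.\<close>

lemma span_image_finite:
  assumes "finite A" and "v \<in> span (f ` A)"
  obtains c where "v = (\<Sum>a\<in>A. c a *s f a)"
  using assms
proof (induction A arbitrary: v thesis rule: finite_induct)
  case empty
  then show ?case by simp
next
  case (insert b A)
  from insert.prems(2) obtain k where "v - k *s f b \<in> span (f ` A)"
    by (auto simp: span_breakdown_eq)
  then obtain c where c: "v - k *s f b = (\<Sum>a\<in>A. c a *s f a)"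
    using insert.IH by blast
  have "v = (\<Sum>a\<in>insert b A. (c(b := k)) a *s f a)"
    using insert.hyps c by (auto simp: algebra_simps intro!: sum.cong)
  then show ?case by (rule insert.prems(1))
qed

lemma independent_family:
  assumes "finite I"
    and zero: "\<And>c i. (\<Sum>i\<in>I. c i *s g i) = 0 \<Longrightarrow> i \<in> I \<Longrightarrow> c i = 0"
  shows "inj_on g I" and "independent (g ` I)"
proof -
  show inj: "inj_on g I"
  proof (rule inj_onI, rule ccontr)
    fix i j assume ij: "i \<in> I" "j \<in> I" "g i = g j" "i \<noteq> j"
    let ?c = "\<lambda>k. if k = i then 1 else if k = j then -1 else (0 :: 'a)"
    have "(\<Sum>k\<in>I. ?c k *s g k) = (\<Sum>k\<in>{i, j}. ?c k *s g k)"
      by (rule sum.mono_neutral_right) (use ij assms(1) in auto)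
    also have "\<dots> = 0" using ij by simp
    finally have "?c i = 0" by (rule zero) (rule ij(1))
    then show False by simp
  qed
  show "independent (g ` I)"
  proof (rule independent_if_scalars_zero)
    fix u v assume "(\<Sum>v\<in>g ` I. u v *s v) = 0" "v \<in> g ` I"
    moreover from this obtain i where "i \<in> I" "v = g i" by blast
    ultimately show "u v = 0"
      using zero[of "\<lambda>i. u (g i)" i] by (simp add: sum.reindex[OF inj] o_def)
  qed (use assms(1) in simp)
qed

end

section \<open>Activity, closed sets and the independence of their products\<close>

locale vector_sequence = vector_space scale
  for scale :: "'a::field \<Rightarrow> 'b::ab_group_add \<Rightarrow> 'b" +
  fixes f :: "nat \<Rightarrow> 'b"
begin

text \<open>External activity of matroid theory, for arbitrary \<open>A\<close>: a position
  \<open>e < N\<close> is active exactly when it is the least element of a circuit contained in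
  \<open>insert e A\<close>.\<close>

definition active :: "nat \<Rightarrow> nat set \<Rightarrow> nat set" where
  "active N A = {e. e < N \<and> f e \<in> span (f ` {a \<in> A. e < a})}"

text \<open>The vectors in \<open>W\<close> count as chosen above every position, which lets an
  induction on \<open>n\<close> absorb \<open>f n\<close>; the final basis uses
  \<open>W = {}\<close>.\<close>

definition active_closed :: "'b set \<Rightarrow> nat \<Rightarrow> nat set set" where
  "active_closed W n =
     {A. A \<subseteq> {..<n} \<and> (\<forall>e<n. e \<notin> A \<longrightarrow> f e \<notin> span (W \<union> f ` {a \<in> A. e < a}))}"

lemma active_closed_empty_iff:
  "A \<in> active_closed {} N \<longleftrightarrow> A \<subseteq> {..<N} \<and> active N A \<subseteq> A"
  by (auto simp: active_closed_def active_def)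

lemma finite_active_closed [simp]: "finite (active_closed W n)"
  by (rule finite_subset[of _ "Pow {..<n}"]) (auto simp: active_closed_def)

text \<open>Every \<open>e < n\<close> sees \<open>n\<close> above it, so a set containing
  \<open>n\<close> behaves as if \<open>f n\<close> were in \<open>W\<close>. If \<open>n\<close> is
  absent, nothing chosen lies above it, and closedness at \<open>n\<close> says
  \<open>f n \<notin> span W\<close>.\<close>

lemma active_closed_Suc:
  "active_closed W (Suc n) =
     insert n ` active_closed (insert (f n) W) n \<union>
     (if f n \<in> span W then {} else active_closed W n)"
proof -
  have ins: "insert n A \<in> active_closed W (Suc n) \<longleftrightarrow> A \<in> active_closed (insert (f n) W) n"
    if "A \<subseteq> {..<n}" for A
  proof -
    have "W \<union> f ` {a \<in> insert n A. e < a} = insert (f n) W \<union> f ` {a \<in> A. e < a}" if "e < n" for e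
      using that by auto
    then show ?thesis
      using that by (auto simp: active_closed_def less_Suc_eq)
  qed
  have no: "A \<in> active_closed W (Suc n) \<longleftrightarrow> f n \<notin> span W \<and> A \<in> active_closed W n"
    if "A \<subseteq> {..<n}" for A
  proof -
    have "{a \<in> A. n < a} = {}" "n \<notin> A" using that by auto
    then have "f ` {a \<in> A. n < a} = {}" by simp
    with that \<open>n \<notin> A\<close> show ?thesis
      by (auto simp: active_closed_def less_Suc_eq simp del: image_is_empty)
  qed
  show ?thesis
  proof (intro set_eqI)
    fix A
    consider "A \<subseteq> {..<n}" | B where "A = insert n B" "B \<subseteq> {..<n}" | "\<not> A \<subseteq> {..<Suc n}"
      by (cases "n \<in> A") (auto simp: less_Suc_eq subset_iff intro: that(2)[of "A - {n}"])
    then show "A \<in> active_closed W (Suc n) \<longleftrightarrow>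
      A \<in> insert n ` active_closed (insert (f n) W) n \<union>
        (if f n \<in> span W then {} else active_closed W n)"
    proof cases
      case 1
      then show ?thesis using no[OF 1] by auto
    next
      case (2 B)
      have "B = C" if "insert n B = insert n C" "C \<in> active_closed (insert (f n) W) n" for C
        using that 2(2) by (auto simp: active_closed_def)
      moreover have "insert n B \<notin> active_closed W n" by (auto simp: active_closed_def)
      ultimately show ?thesis using ins[OF 2(2)] 2(1) by (auto 0 3)
    next
      case 3
      then show ?thesis by (auto simp: active_closed_def)
    qed
  qed
qed

text \<open>Restricting to the hyperplane \<open>\<phi> (f n) = 0\<close> isolates the sets containing \<open>n\<close>; this is
  contraction of \<open>f n\<close>, with \<open>W\<close> collecting the contracted vectors.\<close>

lemma active_closed_products_independent:
  fixes c :: "nat set \<Rightarrow> 'a"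
  assumes inf: "infinite (UNIV :: 'a set)"
    and "\<And>\<phi>. Vector_Spaces.linear scale (*) \<phi> \<Longrightarrow> (\<And>w. w \<in> W \<Longrightarrow> \<phi> w = 0) \<Longrightarrow>
      (\<Sum>A\<in>active_closed W n. c A * (\<Prod>i\<in>{..<n} - A. \<phi> (f i))) = 0"
    and "A \<in> active_closed W n"
  shows "c A = 0"
  using assms(2,3)
proof (induction n arbitrary: W c A)
  case 0
  interpret P: vector_space_pair scale "(*) :: 'a \<Rightarrow> 'a \<Rightarrow> 'a"
    by (rule vector_space_pair_functionals)
  \<comment> \<open>Only the empty set is left and its product is \<open>1\<close>, so the zero
    functional suffices.\<close>
  from 0(1)[OF P.linear_zero] 0(2) show ?case
    by (simp add: active_closed_def cong: conj_cong)
next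
  case (Suc n)
  let ?C = "active_closed (insert (f n) W) n"
  let ?D = "if f n \<in> span W then {} else active_closed W n"
  have sub: "A \<subseteq> {..<n}" if "A \<in> ?C \<union> ?D" for A
    using that by (auto simp: active_closed_def split: if_splits)
  have n_notin: "n \<notin> A" if "A \<in> ?C \<or> A \<in> ?D" for A
    using sub[of A] that by blast
  \<comment> \<open>The factor \<open>\<phi> (f n)\<close> occurs exactly in the terms of sets
    without \<open>n\<close>, so these vanish once it is zero.\<close>
  have split: "(\<Sum>A\<in>active_closed W (Suc n). c A * (\<Prod>i\<in>{..<Suc n} - A. \<phi> (f i))) =
      (\<Sum>A\<in>?C. c (insert n A) * (\<Prod>i\<in>{..<n} - A. \<phi> (f i))) +
      \<phi> (f n) * (\<Sum>A\<in>?D. c A * (\<Prod>i\<in>{..<n} - A. \<phi> (f i)))" for \<phi> :: "'b \<Rightarrow> 'a"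
  proof -
    let ?t = "\<lambda>A. c A * (\<Prod>i\<in>{..<Suc n} - A. \<phi> (f i))"
    have inj: "inj_on (insert n) ?C"
      using n_notin by (intro inj_onI) (metis insert_ident)
    have "insert n ` ?C \<inter> ?D = {}"
      using n_notin by blast
    then have "sum ?t (active_closed W (Suc n)) = sum ?t (insert n ` ?C) + sum ?t ?D"
      unfolding active_closed_Suc by (intro sum.union_disjoint) auto
    also have "sum ?t (insert n ` ?C) = (\<Sum>A\<in>?C. c (insert n A) * (\<Prod>i\<in>{..<n} - A. \<phi> (f i)))"
    proof -
      have "{..<Suc n} - insert n A = {..<n} - A" for A by auto
      then show ?thesis by (simp add: sum.reindex[OF inj])
    qed
    also have "sum ?t ?D = (\<Sum>A\<in>?D. \<phi> (f n) * (c A * (\<Prod>i\<in>{..<n} - A. \<phi> (f i))))"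
    proof (rule sum.cong[OF refl])
      fix A assume "A \<in> ?D"
      then have "{..<Suc n} - A = insert n ({..<n} - A)"
        using n_notin[of A] by (auto simp: less_Suc_eq)
      then show "?t A = \<phi> (f n) * (c A * (\<Prod>i\<in>{..<n} - A. \<phi> (f i)))"
        by (simp add: mult.left_commute)
    qed
    finally show ?thesis by (simp only: sum_distrib_left)
  qed
  have C: "c (insert n A) = 0" if "A \<in> ?C" for A
  proof (rule Suc.IH[where c = "\<lambda>A. c (insert n A)", OF _ that])
    fix \<phi> :: "'b \<Rightarrow> 'a"
    assume "Vector_Spaces.linear scale (*) \<phi>" and "\<And>w. w \<in> insert (f n) W \<Longrightarrow> \<phi> w = 0"
    then show "(\<Sum>A\<in>?C. c (insert n A) * (\<Prod>i\<in>{..<n} - A. \<phi> (f i))) = 0"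
      using Suc.prems(1)[of \<phi>] by (simp add: split)
  qed
  have D: "c A = 0" if "A \<in> ?D" for A
  proof -
    have fn: "f n \<notin> span W" and A: "A \<in> active_closed W n"
      using that by (auto split: if_splits)
    obtain \<psi> where \<psi>: "Vector_Spaces.linear scale (*) \<psi>" "\<forall>w\<in>W. \<psi> w = 0" "\<psi> (f n) = 1"
      using separating_functional[OF fn] by blast
    show ?thesis
    proof (rule Suc.IH[where c = c, OF _ A])
      fix \<phi> :: "'b \<Rightarrow> 'a"
      assume \<phi>: "Vector_Spaces.linear scale (*) \<phi>" "\<And>w. w \<in> W \<Longrightarrow> \<phi> w = 0"
      \<comment> \<open>Along the line \<open>\<phi> + s * \<psi>\<close> the sum becomes a
        polynomial in \<open>s\<close>. For \<open>s \<noteq> - \<phi> (f n)\<close> the factor from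
        \<open>f n\<close> is nonzero and cancels, so \<open>q\<close> has infinitely many roots;
        its value at \<open>0\<close> is the sum wanted.\<close>
      define q where "q = (\<Sum>A\<in>active_closed W n. smult (c A) (\<Prod>i\<in>{..<n} - A. [:\<phi> (f i), \<psi> (f i):]))"
      have q: "poly q s = (\<Sum>A\<in>active_closed W n. c A * (\<Prod>i\<in>{..<n} - A. \<phi> (f i) + s * \<psi> (f i)))" for s
        by (simp add: q_def poly_sum poly_prod)
      have "poly q s = 0" if "s \<noteq> - \<phi> (f n)" for s
      proof -
        interpret P: vector_space_pair scale "(*) :: 'a \<Rightarrow> 'a \<Rightarrow> 'a"
          by (rule vector_space_pair_functionals)
        have "Vector_Spaces.linear scale (*) (\<lambda>u. \<phi> u + s * \<psi> u)"
          using \<phi>(1) \<psi>(1) by (intro P.linear_compose_add P.linear_compose_scale_right)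
        from Suc.prems(1)[OF this]
        have "(\<Sum>A\<in>active_closed W (Suc n). c A * (\<Prod>i\<in>{..<Suc n} - A. \<phi> (f i) + s * \<psi> (f i))) = 0"
          by (simp add: \<phi>(2) \<psi>(2))
        then have "(\<phi> (f n) + s) * poly q s = 0"
          unfolding split[of "\<lambda>u. \<phi> u + s * \<psi> u"] q by (simp add: fn \<psi>(3) C)
        moreover have "\<phi> (f n) + s \<noteq> 0"
          using that unfolding eq_neg_iff_add_eq_0 by (subst add.commute)
        ultimately show ?thesis by simp
      qed
      then have "UNIV - {- \<phi> (f n)} \<subseteq> {s. poly q s = 0}" by auto
      moreover have "infinite (UNIV - {- \<phi> (f n)})" using inf by simp
      ultimately have "infinite {s. poly q s = 0}"
        using finite_subset by blast
      then have "q = 0"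
        using poly_roots_finite by blast
      then show "(\<Sum>A\<in>active_closed W n. c A * (\<Prod>i\<in>{..<n} - A. \<phi> (f i))) = 0"
        using q[of 0] by simp
    qed
  qed
  show ?case
    using Suc.prems(2) C D unfolding active_closed_Suc by blast
qed

section \<open>Lexicographic bases and the partition into intervals\<close>

definition lex_basis :: "nat set \<Rightarrow> nat set" where
  "lex_basis A = {a \<in> A. f a \<notin> span (f ` {b \<in> A. a < b})}"

lemma lex_basis_subset: "lex_basis A \<subseteq> A"
  by (auto simp: lex_basis_def)

text \<open>Whether \<open>a\<close> is kept depends only on the members of \<open>A\<close> above
  \<open>a\<close>.\<close>

lemma lex_basis_above: "{a \<in> lex_basis A. e < a} = lex_basis {a \<in> A. e < a}"
proof -
  have "{b \<in> {a \<in> A. e < a}. a < b} = {b \<in> A. a < b}" if "e < a" for a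
    using that by auto
  then show ?thesis by (auto simp: lex_basis_def)
qed

text \<open>\<open>lex_basis\<close> is the greedy choice from the largest position down: inserting
  a new minimum leaves earlier decisions alone, and the minimum is kept precisely when it enlarges
  the span.\<close>

lemma lex_basis_properties:
  assumes "finite A"
  shows "span (f ` lex_basis A) = span (f ` A)" (is ?span)
    and "inj_on f (lex_basis A)" (is ?inj)
    and "independent (f ` lex_basis A)" (is ?indep)
proof -
  from assms have "?span \<and> ?inj \<and> ?indep"
  proof (induction A rule: finite_linorder_min_induct)
    case empty
    then show ?case by (simp add: lex_basis_def independent_empty)
  next
    case (insert b A)
    have "{c \<in> insert b A. a < c} = {c \<in> A. a < c}" if "a \<in> A" for a
      using insert.hyps(2) that by auto
    moreover have "{c \<in> insert b A. b < c} = A"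
      using insert.hyps(2) by auto
    ultimately have eq: "lex_basis (insert b A) =
        (if f b \<in> span (f ` A) then lex_basis A else insert b (lex_basis A))"
      by (auto simp: lex_basis_def)
    show ?case
    proof (cases "f b \<in> span (f ` A)")
      case True
      then show ?thesis using insert.IH eq by (simp add: span_redundant)
    next
      case False
      have "f b \<notin> f ` lex_basis A"
        using False insert.IH span_base by metis
      with False show ?thesis
        using insert.IH eq by (auto simp: independent_insertI span_insert)
    qed
  qed
  then show ?span ?inj ?indep by blast+
qed

lemma dim_eq_card_lex_basis: "finite A \<Longrightarrow> dim (f ` A) = card (lex_basis A)"
  using dim_eq_card[of "f ` lex_basis A" "f ` A"] lex_basis_properties[of A]
  by (simp add: card_image)

lemma lex_basis_eq: "A \<subseteq> {..<N} \<Longrightarrow> lex_basis A = A - active N A"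
  by (auto simp: lex_basis_def active_def)

text \<open>An active \<open>b\<close> lies in the span of the members of \<open>A\<close> above
  \<open>b\<close>, hence of those above any \<open>e < b\<close>; adding it leaves the spans that
  define activity unchanged.\<close>

lemma active_eq_if_subset_Un_active:
  assumes "A \<subseteq> B" "B \<subseteq> A \<union> active N A"
  shows "active N B = active N A"
proof -
  have "span (f ` {b \<in> B. e < b}) = span (f ` {a \<in> A. e < a})" for e
    unfolding span_eq
  proof
    show "f ` {b \<in> B. e < b} \<subseteq> span (f ` {a \<in> A. e < a})"
    proof safe
      fix b assume b: "b \<in> B" "e < b"
      show "f b \<in> span (f ` {a \<in> A. e < a})"
      proof (cases "b \<in> A")
        case True
        then show ?thesis using b(2) by (auto intro: span_base)
      next
        case False
        then have "f b \<in> span (f ` {a \<in> A. b < a})"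
          using b(1) assms(2) by (auto simp: active_def)
        also have "\<dots> \<subseteq> span (f ` {a \<in> A. e < a})"
          using b(2) by (intro span_mono image_mono) auto
        finally show ?thesis .
      qed
    qed
    show "f ` {a \<in> A. e < a} \<subseteq> span (f ` {b \<in> B. e < b})"
      using assms(1) by (auto intro: span_base)
  qed
  then show ?thesis by (simp add: active_def)
qed

text \<open>By \<open>lex_basis_above\<close>, the parts of \<open>lex_basis B\<close>,
  \<open>A\<close> and \<open>B\<close> above any \<open>e\<close> have the same span.\<close>

lemma active_between_lex_basis:
  assumes "finite B" "lex_basis B \<subseteq> A" "A \<subseteq> B"
  shows "active N A = active N B"
proof -
  have "span (f ` {a \<in> A. e < a}) = span (f ` {b \<in> B. e < b})" for e
  proof (rule antisym)
    show "span (f ` {a \<in> A. e < a}) \<subseteq> span (f ` {b \<in> B. e < b})"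
      using assms(3) by (intro span_mono image_mono) auto
    have "span (f ` {b \<in> B. e < b}) = span (f ` {a \<in> lex_basis B. e < a})"
      using assms(1) by (simp add: lex_basis_above lex_basis_properties(1))
    also have "\<dots> \<subseteq> span (f ` {a \<in> A. e < a})"
      using assms(2) by (intro span_mono image_mono) auto
    finally show "span (f ` {b \<in> B. e < b}) \<subseteq> span (f ` {a \<in> A. e < a})" .
  qed
  then show ?thesis by (simp add: active_def)
qed

text \<open>Adding the active positions creates no new ones, so a single step closes
  \<open>A\<close>.\<close>

lemma Un_active_closed:
  assumes "A \<subseteq> {..<N}"
  shows "A \<union> active N A \<in> active_closed {} N"
  using assms active_eq_if_subset_Un_active[of A "A \<union> active N A" N]
  by (auto simp: active_closed_empty_iff active_def[of _ A])

text \<open>Since \<open>lex_basis B = B - active N B\<close>, the inactive members of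
  \<open>B\<close> must come from \<open>A\<close>. Conversely, a set between the two has the
  activity of \<open>B\<close>, which supplies what is missing and nothing outside
  \<open>B\<close>.\<close>

lemma Un_active_eq_iff:
  assumes B: "B \<in> active_closed {} N"
  shows "A \<union> active N A = B \<longleftrightarrow> lex_basis B \<subseteq> A \<and> A \<subseteq> B"
proof -
  have B': "B \<subseteq> {..<N}" "active N B \<subseteq> B"
    using B by (simp_all add: active_closed_empty_iff)
  have fin: "finite B" using B'(1) finite_subset by blast
  show ?thesis
  proof
    assume eq: "A \<union> active N A = B"
    then have "active N B = active N A"
      by (intro active_eq_if_subset_Un_active) auto
    with eq show "lex_basis B \<subseteq> A \<and> A \<subseteq> B"
      by (auto simp: lex_basis_eq[OF B'(1)])
  next
    assume "lex_basis B \<subseteq> A \<and> A \<subseteq> B"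
    moreover from this have "active N A = active N B"
      using active_between_lex_basis[OF fin] by blast
    ultimately show "A \<union> active N A = B"
      using B'(2) by (auto simp: lex_basis_eq[OF B'(1)])
  qed
qed

text \<open>The fibre of \<open>A \<mapsto> A \<union> active N A\<close> over a closed \<open>B\<close> is the Boolean interval from
  \<open>lex_basis B\<close> to \<open>B\<close>, on which the rank is constant.\<close>

lemma sum_rank_nullity_eq_sum_active_closed:
  fixes x :: "'c::field"
  assumes x: "x \<noteq> 0"
    and G: "\<And>A B. span (f ` A) = span (f ` B) \<Longrightarrow> G A = G B"
  shows "(\<Sum>A | A \<subseteq> {..<N} \<and> G A. x ^ (N - dim (f ` A)) * (1 / x - 1) ^ (card A - dim (f ` A))) =
    (\<Sum>B | B \<in> active_closed {} N \<and> G B. x ^ (N - card B))"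
proof -
  let ?h = "\<lambda>A. x ^ (N - dim (f ` A)) * (1 / x - 1) ^ (card A - dim (f ` A))"
  let ?S = "{A. A \<subseteq> {..<N} \<and> G A}" and ?T = "{B. B \<in> active_closed {} N \<and> G B}"
  have finS: "finite ?S" by (rule finite_subset[of _ "Pow {..<N}"]) auto
  have span_between: "span (f ` A) = span (f ` B)"
    if "finite B" "lex_basis B \<subseteq> A" "A \<subseteq> B" for A B
  proof (rule antisym)
    show "span (f ` A) \<subseteq> span (f ` B)"
      by (intro span_mono image_mono that(3))
    have "span (f ` B) = span (f ` lex_basis B)"
      by (rule lex_basis_properties(1)[OF that(1), symmetric])
    also have "\<dots> \<subseteq> span (f ` A)"
      by (intro span_mono image_mono that(2))
    finally show "span (f ` B) \<subseteq> span (f ` A)" .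
  qed
  have fib: "sum ?h {A \<in> ?S. A \<union> active N A = B} = x ^ (N - card B)" if "B \<in> ?T" for B
  proof -
    have B: "B \<in> active_closed {} N" "G B" "B \<subseteq> {..<N}" using that
      by (auto simp: active_closed_def)
    have fin: "finite B" using B(3) finite_subset by blast
    let ?L = "lex_basis B"
    let ?E = "B - ?L"
    have L: "?L \<subseteq> B" by (rule lex_basis_subset)
    have finL: "finite ?L" using L fin finite_subset by blast
    have set: "{A \<in> ?S. A \<union> active N A = B} = (\<lambda>S. ?L \<union> S) ` Pow ?E"
    proof -
      have "G A" "A \<subseteq> {..<N}" if "?L \<subseteq> A" "A \<subseteq> B" for A
        using G[OF span_between[OF fin that]] B(2,3) that(2) by auto
      then have "{A \<in> ?S. A \<union> active N A = B} = {A. ?L \<subseteq> A \<and> A \<subseteq> B}"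
        unfolding Un_active_eq_iff[OF B(1)] by blast
      also have "\<dots> = (\<lambda>S. ?L \<union> S) ` Pow ?E"
      proof safe
        fix A assume "?L \<subseteq> A" "A \<subseteq> B"
        then show "A \<in> (\<lambda>S. ?L \<union> S) ` Pow ?E"
          by (intro image_eqI[of _ _ "A - ?L"]) auto
      qed (use L in auto)
      finally show ?thesis .
    qed
    have h: "?h (?L \<union> S) = x ^ (N - card ?L) * (1 / x - 1) ^ card S" if "S \<in> Pow ?E" for S
    proof -
      have "dim (f ` (?L \<union> S)) = dim (f ` B)"
        using span_between[OF fin, of "?L \<union> S"] that L by (intro span_eq_dim) auto
      moreover have "card (?L \<union> S) = card ?L + card S"
        using that fin finL by (intro card_Un_disjoint) (auto intro: finite_subset)
      ultimately show ?thesis using dim_eq_card_lex_basis[OF fin] by simp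
    qed
    have "sum ?h {A \<in> ?S. A \<union> active N A = B} = (\<Sum>S\<in>Pow ?E. ?h (?L \<union> S))"
      unfolding set by (subst sum.reindex) (auto simp: inj_on_def)
    also have "\<dots> = x ^ (N - card ?L) * (\<Sum>S\<in>Pow ?E. (1 / x - 1) ^ card S)"
      by (simp add: h sum_distrib_left)
    \<comment> \<open>The binomial sum with \<open>1 + (1 / x - 1) = 1 / x\<close>; these powers
      then cancel against \<open>card ?E\<close> powers of \<open>x\<close>.\<close>
    also have "\<dots> = x ^ (N - card ?L) * (1 / x) ^ card ?E"
      using fin by (subst sum_Pow_power_card) auto
    also have "N - card ?L = (N - card B) + card ?E"
      using card_Diff_subset[OF finL L] card_mono[OF fin L] card_mono[OF finite_lessThan B(3)]
      by simp
    finally show ?thesis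
      using x by (simp add: power_add power_one_over)
  qed
  have image: "(\<lambda>A. A \<union> active N A) ` ?S \<subseteq> ?T"
  proof safe
    fix A assume A: "A \<subseteq> {..<N}" "G A"
    show cl: "A \<union> active N A \<in> active_closed {} N" by (rule Un_active_closed[OF A(1)])
    then have "lex_basis (A \<union> active N A) \<subseteq> A"
      using Un_active_eq_iff by blast
    moreover have "finite (A \<union> active N A)"
      using cl by (auto simp: active_closed_def intro: finite_subset)
    ultimately have "span (f ` A) = span (f ` (A \<union> active N A))"
      using span_between[of "A \<union> active N A" A] by simp
    from G[OF this] A(2) show "G (A \<union> active N A)" by simp
  qed
  have "sum ?h ?S = (\<Sum>B\<in>?T. sum ?h {A \<in> ?S. A \<union> active N A = B})"
    by (rule sum.group[OF finS _ image, symmetric]) simp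
  also have "\<dots> = (\<Sum>B\<in>?T. x ^ (N - card B))"
    by (rule sum.cong[OF refl fib])
  finally show ?thesis .
qed

end

section \<open>The basis of products in the symmetric algebra\<close>

locale symmetric_algebra_sequence =
  symmetric_algebra scaleU scaleS p + V: vector_sequence scaleU f
  for scaleU :: "'k::field_char_0 \<Rightarrow> 'u::ab_group_add \<Rightarrow> 'u"
    and scaleS :: "'k \<Rightarrow> 's::comm_ring_1 \<Rightarrow> 's"
    and p :: "'u \<Rightarrow> 's" and f :: "nat \<Rightarrow> 'u"
begin

text \<open>Indexed by the positions left out, because the condition on the generators of
  \<open>P_space\<close> concerns the complement of \<open>Y\<close>.\<close>

definition cofactor :: "nat \<Rightarrow> nat set \<Rightarrow> 's" where
  "cofactor n A = (\<Prod>i\<in>{..<n} - A. p (f i))"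

text \<open>The universal property with the field as target; elements of the symmetric algebra
  thereby act as polynomial functions on the dual of \<open>U\<close>.\<close>

lemma evaluation:
  assumes "Vector_Spaces.linear scaleU (*) \<phi>"
  obtains h where "Vector_Spaces.linear scaleS (*) h" "h 1 = 1" "\<And>x y. h (x * y) = h x * h y"
    "\<And>u. h (p u) = \<phi> u"
proof -
  have "commutative_algebra ((*) :: 'k \<Rightarrow> 'k \<Rightarrow> 'k)"
    by unfold_locales (simp_all add: algebra_simps)
  from ex1_implies_ex[OF universal_property[OF this assms]] obtain h
    where h: "Vector_Spaces.linear scaleS (*) h \<and> h 1 = 1 \<and> (\<forall>x y. h (x * y) = h x * h y) \<and> (\<forall>u. h (p u) = \<phi> u)" ..
  show thesis
    by (rule that[of h]) (simp_all add: h)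
qed

lemma hom_prod:
  fixes h :: "'s \<Rightarrow> 'k"
  assumes "h 1 = 1" "\<And>x y. h (x * y) = h x * h y"
  shows "h (prod q I) = (\<Prod>i\<in>I. h (q i))"
  by (induction I rule: infinite_finite_induct) (simp_all add: assms)

text \<open>Each of the \<open>i\<close> generators in a product contributes one factor
  \<open>2\<close>, and both maps are linear.\<close>

lemma graded_part_double:
  fixes h h' :: "'s \<Rightarrow> 'k"
  assumes h: "Vector_Spaces.linear scaleS (*) h" "h 1 = 1" "\<And>x y. h (x * y) = h x * h y"
    and h': "Vector_Spaces.linear scaleS (*) h'" "h' 1 = 1" "\<And>x y. h' (x * y) = h' x * h' y"
    and double: "\<And>u. h' (p u) = 2 * h (p u)"
    and y: "y \<in> sym_graded_part scaleS p i"
  shows "h' y = 2 ^ i * h y"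
proof -
  interpret h: Vector_Spaces.linear scaleS "(*)" h by fact
  interpret h': Vector_Spaces.linear scaleS "(*)" h' by fact
  have *: "h' (prod_list (map p us)) = 2 ^ length us * h (prod_list (map p us))" for us
    by (induction us) (simp_all add: h h' double)
  have "y \<in> S.span {prod_list (map p us) | us. length us = i}"
    using y by (simp add: sym_graded_part_def)
  then show ?thesis
    by (induction rule: S.span_induct_alt)
      (auto simp: * h.add h'.add h.scale h'.scale h.zero h'.zero distrib_left mult.left_commute)
qed

text \<open>Evaluating at \<open>\<phi>\<close> and at \<open>2\<phi>\<close> multiplies a homogeneous element of degree \<open>i\<close> by \<open>2 ^ i\<close>,
  which separates the degrees.\<close>

lemma cofactor_coefficient_degree:
  assumes "(\<Sum>A\<in>V.active_closed {} n. scaleS (c A) (cofactor n A)) \<in> sym_graded_part scaleS p i"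
    and A: "A \<in> V.active_closed {} n" "c A \<noteq> 0"
  shows "n - card A = i"
proof -
  let ?y = "\<Sum>A\<in>V.active_closed {} n. scaleS (c A) (cofactor n A)"
  \<comment> \<open>\<open>h' ?y = 2 ^ i * h ?y\<close>, written out for every functional, is a
    vanishing combination of the products with these coefficients.\<close>
  have "c A * (2 ^ (n - card A) - 2 ^ i) = 0"
  proof (rule V.active_closed_products_independent[
        where c = "\<lambda>A. c A * (2 ^ (n - card A) - 2 ^ i)", OF infinite_UNIV_char_0 _ A(1)])
    fix \<phi> :: "'u \<Rightarrow> 'k"
    assume \<phi>: "Vector_Spaces.linear scaleU (*) \<phi>"
    interpret F: vector_space_pair scaleU "(*) :: 'k \<Rightarrow> 'k \<Rightarrow> 'k"
      by (rule U.vector_space_pair_functionals)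
    have \<phi>2: "Vector_Spaces.linear scaleU (*) (\<lambda>u. 2 * \<phi> u)"
      using \<phi> by (rule F.linear_compose_scale_right)
    obtain h where h: "Vector_Spaces.linear scaleS (*) h" "h 1 = 1"
      "\<And>x y. h (x * y) = h x * h y" "\<And>u. h (p u) = \<phi> u"
      using evaluation[OF \<phi>] by blast
    obtain h' where h': "Vector_Spaces.linear scaleS (*) h'" "h' 1 = 1"
      "\<And>x y. h' (x * y) = h' x * h' y" "\<And>u. h' (p u) = 2 * \<phi> u"
      using evaluation[OF \<phi>2] by blast
    interpret h: Vector_Spaces.linear scaleS "(*)" h by (rule h(1))
    interpret h': Vector_Spaces.linear scaleS "(*)" h' by (rule h'(1))
    let ?m = "\<lambda>B. \<Prod>i\<in>{..<n} - B. \<phi> (f i)"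
    have "h' ?y = (\<Sum>B\<in>V.active_closed {} n. c B * (2 ^ (n - card B) * ?m B))"
    proof -
      have "h' (cofactor n B) = 2 ^ (n - card B) * ?m B" if "B \<in> V.active_closed {} n" for B
      proof -
        have "card ({..<n} - B) = n - card B"
          using that by (subst card_Diff_subset) (auto simp: V.active_closed_def intro: finite_subset)
        then show ?thesis
          unfolding cofactor_def hom_prod[of h', OF h'(2,3)] h'(4) by (simp add: prod.distrib)
      qed
      then show ?thesis
        unfolding h'.sum h'.scale by (intro sum.cong) simp_all
    qed
    moreover have "h ?y = (\<Sum>B\<in>V.active_closed {} n. c B * ?m B)"
      unfolding h.sum h.scale cofactor_def hom_prod[of h, OF h(2,3)] h(4) ..
    moreover have "h' ?y = 2 ^ i * h ?y"
      by (rule graded_part_double[OF h(1-3) h'(1-3) _ assms(1)]) (simp add: h(4) h'(4))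
    ultimately have eq: "(\<Sum>B\<in>V.active_closed {} n. c B * (2 ^ (n - card B) * ?m B)) =
        2 ^ i * (\<Sum>B\<in>V.active_closed {} n. c B * ?m B)"
      by simp
    have "c B * (2 ^ (n - card B) - 2 ^ i) * ?m B =
        c B * (2 ^ (n - card B) * ?m B) - 2 ^ i * (c B * ?m B)" for B
      by (simp only: left_diff_distrib right_diff_distrib mult.assoc mult.left_commute)
    then show "(\<Sum>B\<in>V.active_closed {} n. c B * (2 ^ (n - card B) - 2 ^ i) * ?m B) = 0"
      by (simp only: sum_subtractf eq sum_distrib_left[symmetric] diff_self)
  qed
  with A(2) have "(2 :: 'k) ^ (n - card A) = 2 ^ i" by simp
  \<comment> \<open>In characteristic zero the two powers can be compared as natural
    numbers.\<close>
  then have "of_nat (2 ^ (n - card A)) = (of_nat (2 ^ i) :: 'k)" by simp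
  then have "(2 :: nat) ^ (n - card A) = 2 ^ i"
    by (rule of_nat_eq_iff[THEN iffD1])
  then show ?thesis by simp
qed

text \<open>Zero is homogeneous of every degree, so a nonzero coefficient would force
  \<open>n - card A\<close> to equal every \<open>i\<close>.\<close>

lemma cofactor_independent:
  shows "inj_on (cofactor n) (V.active_closed {} n)"
    and "S.independent (cofactor n ` V.active_closed {} n)"
proof -
  have zero: "c A = 0" if sum: "(\<Sum>A\<in>V.active_closed {} n. scaleS (c A) (cofactor n A)) = 0"
    and A: "A \<in> V.active_closed {} n" for c A
  proof (rule ccontr)
    assume "c A \<noteq> 0"
    have "(\<Sum>A\<in>V.active_closed {} n. scaleS (c A) (cofactor n A)) \<in> sym_graded_part scaleS p i" for i
      unfolding sum sym_graded_part_def by (rule S.span_zero)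
    from cofactor_coefficient_degree[OF this A \<open>c A \<noteq> 0\<close>] show False
      by (metis n_not_Suc_n)
  qed
  show "inj_on (cofactor n) (V.active_closed {} n)"
    by (rule S.independent_family(1)[OF V.finite_active_closed]) (erule (1) zero)
  show "S.independent (cofactor n ` V.active_closed {} n)"
    by (rule S.independent_family(2)[OF V.finite_active_closed]) (erule (1) zero)
qed

text \<open>If \<open>f e\<close> is a combination of the \<open>f a\<close> with \<open>a \<in> A\<close> and \<open>e < a\<close>, expanding the factor
  \<open>p (f e)\<close> replaces \<open>A\<close> by sets \<open>A \<union> {e} - {a}\<close> with the same span and smaller index sum.\<close>

lemma cofactor_in_span:
  assumes G: "\<And>A B. U.span (f ` A) = U.span (f ` B) \<Longrightarrow> G A = G B"
    and "A \<subseteq> {..<n}" "G A"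
  shows "cofactor n A \<in> S.span (cofactor n ` {B \<in> V.active_closed {} n. G B})"
  using assms(2,3)
proof (induction "\<Sum>A" arbitrary: A rule: less_induct)
  case less
  let ?R = "S.span (cofactor n ` {B \<in> V.active_closed {} n. G B})"
  interpret p: Vector_Spaces.linear scaleU scaleS p by (rule linear_p)
  have finA: "finite A" using less.prems(1) finite_subset by blast
  show ?case
  proof (cases "A \<in> V.active_closed {} n")
    case True
    then show ?thesis using less.prems(2) by (auto intro: S.span_base)
  next
    case False
    then obtain e where e: "e < n" "e \<notin> A" "f e \<in> U.span (f ` {a \<in> A. e < a})"
      using less.prems(1) by (auto simp: V.active_closed_def)
    let ?A' = "{a \<in> A. e < a}"
    have finA': "finite ?A'" using finA by simp
    obtain c where c: "f e = (\<Sum>a\<in>?A'. scaleU (c a) (f a))"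
      using U.span_image_finite[OF finA' e(3)] by blast
    have eq: "{..<n} - A = insert e ({..<n} - insert e A)" using e by auto
    have "cofactor n A = p (f e) * cofactor n (insert e A)"
      unfolding cofactor_def eq by (subst prod.insert) simp_all
    also have "\<dots> = (\<Sum>a\<in>?A'. scaleS (c a) (p (f a) * cofactor n (insert e A)))"
      unfolding c by (simp add: p.sum p.scale sum_distrib_right S.scale_mult_left)
    also have "\<dots> = (\<Sum>a\<in>?A'. scaleS (c a) (cofactor n (insert e A - {a})))"
    proof (rule sum.cong[OF refl])
      fix a assume a: "a \<in> ?A'"
      then have "{..<n} - (insert e A - {a}) = insert a ({..<n} - insert e A)"
        using less.prems(1) by auto
      moreover have "a \<notin> {..<n} - insert e A" using a by auto
      ultimately show "scaleS (c a) (p (f a) * cofactor n (insert e A)) =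
          scaleS (c a) (cofactor n (insert e A - {a}))"
        unfolding cofactor_def by simp
    qed
    also have "\<dots> \<in> ?R"
    proof (rule S.span_sum)
      fix a assume a: "a \<in> ?A'"
      let ?B = "insert e A - {a}"
      show "scaleS (c a) (cofactor n ?B) \<in> ?R"
      proof (cases "c a = 0")
        case True
        then show ?thesis by (simp add: S.span_zero)
      next
        case False
        \<comment> \<open>As \<open>c a\<close> is nonzero, the dependency can be solved for
          \<open>f a\<close>, so exchanging \<open>a\<close> for \<open>e\<close> keeps the
          span.\<close>
        have "f e = scaleU (c a) (f a) + (\<Sum>b\<in>?A' - {a}. scaleU (c b) (f b))"
          using c sum.remove[OF finA' a, of "\<lambda>b. scaleU (c b) (f b)"] by simp
        then have "scaleU (c a) (f a) = f e - (\<Sum>b\<in>?A' - {a}. scaleU (c b) (f b))"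
          by simp
        also have "\<dots> \<in> U.span (f ` ?B)"
          using a by (intro U.span_diff U.span_sum U.span_scale U.span_base) auto
        finally have fa: "f a \<in> U.span (f ` ?B)"
          using U.span_scale[of "scaleU (c a) (f a)" _ "1 / c a"] False by simp
        have "U.span (f ` ?B) = U.span (f ` A)"
          unfolding U.span_eq
        proof
          show "f ` ?B \<subseteq> U.span (f ` A)"
            using e(3) U.span_mono[of "f ` ?A'" "f ` A"] by (auto intro: U.span_base)
          show "f ` A \<subseteq> U.span (f ` ?B)"
          proof safe
            fix b assume "b \<in> A"
            then show "f b \<in> U.span (f ` ?B)"
              using fa by (cases "b = a") (auto intro: U.span_base)
          qed
        qed
        then have "G ?B" using G less.prems(2) by blast
        moreover have "\<Sum>?B < \<Sum>A"
        proof -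
          have "\<Sum>?B + a = \<Sum>(insert e A)"
            using a finA by (simp add: sum.remove[of "insert e A" a])
          also have "\<dots> = e + \<Sum>A" using e finA by simp
          finally show ?thesis using a by simp
        qed
        moreover have "?B \<subseteq> {..<n}" using e less.prems(1) by auto
        ultimately show ?thesis by (intro S.span_scale less.hyps)
      qed
    qed
    finally show ?thesis .
  qed
qed

lemma prod_in_sym_graded_part:
  assumes "finite I"
  shows "(\<Prod>i\<in>I. p (f i)) \<in> sym_graded_part scaleS p (card I)"
proof -
  obtain js where "set js = I" "distinct js"
    using finite_distinct_list[OF assms] by blast
  then have "(\<Prod>i\<in>I. p (f i)) = prod_list (map p (map f js))" "card I = length (map f js)"
    by (auto simp: prod.distinct_set_conv_list o_def distinct_card)
  then show ?thesis
    unfolding sym_graded_part_def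
    by (intro S.span_base CollectI exI[of _ "map f js"] conjI) simp_all
qed

text \<open>Expanded in cofactors of closed sets satisfying \<open>G\<close>, an element of degree
  \<open>i\<close> involves only those of degree \<open>i\<close>, which therefore form a basis of
  the graded part.\<close>

lemma dim_cofactor_span_graded:
  assumes G: "\<And>A B. U.span (f ` A) = U.span (f ` B) \<Longrightarrow> G A = G B"
  shows "S.dim (S.span (cofactor n ` {A. A \<subseteq> {..<n} \<and> G A}) \<inter> sym_graded_part scaleS p i) =
    card {B \<in> V.active_closed {} n. G B \<and> n - card B = i}"
proof -
  let ?C = "V.active_closed {} n"
  let ?P = "S.span (cofactor n ` {A. A \<subseteq> {..<n} \<and> G A})"
  let ?B = "{B \<in> ?C. G B \<and> n - card B = i}"
  have "?P = S.span (cofactor n ` {B \<in> ?C. G B})"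
  proof (rule antisym)
    show "?P \<subseteq> S.span (cofactor n ` {B \<in> ?C. G B})"
      proof (rule S.span_minimal[OF image_subsetI S.subspace_span])
      fix A assume "A \<in> {A. A \<subseteq> {..<n} \<and> G A}"
      then show "cofactor n A \<in> S.span (cofactor n ` {B \<in> ?C. G B})"
        using cofactor_in_span[where G = G, OF G] by simp
    qed
    show "S.span (cofactor n ` {B \<in> ?C. G B}) \<subseteq> ?P"
      by (intro S.span_mono image_mono) (auto simp: V.active_closed_def)
  qed
  note P = this
  show ?thesis
  proof (rule S.dim_unique[of "cofactor n ` ?B"])
    have "cofactor n B \<in> sym_graded_part scaleS p (n - card B)" if "B \<in> ?C" for B
    proof -
      have "card ({..<n} - B) = n - card B"
        using that by (subst card_Diff_subset) (auto simp: V.active_closed_def intro: finite_subset)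
      then show ?thesis
        using prod_in_sym_graded_part[of "{..<n} - B"] by (simp add: cofactor_def)
    qed
    then show "cofactor n ` ?B \<subseteq> ?P \<inter> sym_graded_part scaleS p i"
      unfolding P by (auto intro: S.span_base)
    show "S.independent (cofactor n ` ?B)"
      by (rule S.independent_mono[OF cofactor_independent(2)]) auto
    show "card (cofactor n ` ?B) = card ?B"
      by (intro card_image inj_on_subset[OF cofactor_independent(1)]) auto
    show "?P \<inter> sym_graded_part scaleS p i \<subseteq> S.span (cofactor n ` ?B)"
    proof safe
      fix y assume y: "y \<in> ?P" "y \<in> sym_graded_part scaleS p i"
      have "finite {B \<in> ?C. G B}" by simp
      from this y(1) obtain c where c: "y = (\<Sum>B | B \<in> ?C \<and> G B. scaleS (c B) (cofactor n B))"
        unfolding P by (rule S.span_image_finite)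
      \<comment> \<open>Coefficients are extended by zero to all closed sets, the form needed for
        \<open>cofactor_coefficient_degree\<close>.\<close>
      also have "\<dots> = (\<Sum>B\<in>?C. scaleS (if G B then c B else 0) (cofactor n B))"
        by (rule sum.mono_neutral_cong_left) auto
      finally have y_eq: "y = (\<Sum>B\<in>?C. scaleS (if G B then c B else 0) (cofactor n B))" .
      have "scaleS (c B) (cofactor n B) \<in> S.span (cofactor n ` ?B)" if B: "B \<in> ?C" "G B" for B
      proof (cases "c B = 0")
        case True
        then show ?thesis by (simp add: S.span_zero)
      next
        case False
        have "n - card B = i"
        proof (rule cofactor_coefficient_degree[where c = "\<lambda>B. if G B then c B else 0"])
          show "(\<Sum>B\<in>?C. scaleS (if G B then c B else 0) (cofactor n B)) \<in> sym_graded_part scaleS p i"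
            using y(2) unfolding y_eq .
        qed (use B False in simp_all)
        with B have "B \<in> ?B" by simp
        then show ?thesis by (intro S.span_scale S.span_base imageI)
      qed
      then show "y \<in> S.span (cofactor n ` ?B)"
        unfolding c by (intro S.span_sum) auto
    qed
  qed
qed

end

section \<open>The Hilbert series\<close>

theorem theorem5p4:
  fixes scaleU :: "'k::field_char_0 \<Rightarrow> 'u::ab_group_add \<Rightarrow> 'u"
    and scaleS :: "'k \<Rightarrow> 's::comm_ring_1 \<Rightarrow> 's"
    and p :: "'u \<Rightarrow> 's"
    and X :: "'u list"
    and J :: "nat set set"
    and N r :: nat
  assumes "symmetric_algebra scaleU scaleS p"
    and "vector_space.dim scaleU UNIV = r"
    and "r \<ge> 1"
    and "length X = N"
    and "module.span scaleU (set X) = UNIV"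
    and "upper_set scaleU X J"
    and "J \<noteq> {}"
  shows "hilbert_series scaleS p (P_space scaleU scaleS p X J) =
    fls_X ^ (N - r) *
      (\<Sum>A | A \<subseteq> {..<N} \<and> chi scaleU X J A = 1.
         fls_X ^ (r - seq_rank scaleU X A) *
         (1 / fls_X - 1) ^ (card A - seq_rank scaleU X A))"
proof -
  interpret symmetric_algebra scaleU scaleS p by fact
  interpret symmetric_algebra_sequence scaleU scaleS p "(!) X" ..
  let ?G = "\<lambda>A. seq_clos scaleU X A \<in> J"
  let ?C = "{B \<in> V.active_closed {} N. ?G B}"
  have rank: "seq_rank scaleU X A = U.dim ((!) X ` A)" for A
    by (simp add: seq_rank_def)
  \<comment> \<open>Closure compares ranks, so it depends on a set of positions only through its
    span, as the lemmas on \<open>G\<close> require.\<close>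
  have G: "?G A = ?G B" if "U.span ((!) X ` A) = U.span ((!) X ` B)" for A B
  proof -
    have "U.span ((!) X ` insert z A) = U.span ((!) X ` insert z B)" for z
      using that by (simp add: U.span_insert)
    with that show ?thesis by (simp add: seq_clos_def seq_rank_def)
  qed
  have chi: "chi scaleU X J A = 1 \<longleftrightarrow> ?G A" for A
    by (simp add: chi_def indicator_def)
  have P: "P_space scaleU scaleS p X J = S.span (cofactor N ` {A. A \<subseteq> {..<N} \<and> ?G A})"
  proof -
    have "{p_prod p X Y | Y. Y \<subseteq> {..<N} \<and> ?G ({..<N} - Y)} =
        cofactor N ` {A. A \<subseteq> {..<N} \<and> ?G A}"
    proof safe
      fix Y assume Y: "Y \<subseteq> {..<N}" "?G ({..<N} - Y)"
      then have "p_prod p X Y = cofactor N ({..<N} - Y)"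
        by (simp add: p_prod_def cofactor_def double_diff)
      then show "p_prod p X Y \<in> cofactor N ` {A. A \<subseteq> {..<N} \<and> ?G A}"
        using Y by blast
    next
      fix A assume A: "A \<subseteq> {..<N}" "?G A"
      then have "{..<N} - ({..<N} - A) = A" by blast
      with A show "\<exists>Y. cofactor N A = p_prod p X Y \<and> Y \<subseteq> {..<N} \<and> ?G ({..<N} - Y)"
        by (intro exI[of _ "{..<N} - A"]) (simp add: p_prod_def cofactor_def)
    qed
    then show ?thesis by (simp add: P_space_def assms(4))
  qed
  have "hilbert_series scaleS p (P_space scaleU scaleS p X J) =
      fps_to_fls (\<Sum>B\<in>?C. fps_X ^ (N - card B))"
  proof -
    have "Abs_fps (\<lambda>i. of_nat (card {B \<in> V.active_closed {} N. ?G B \<and> N - card B = i})) =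
        (\<Sum>B\<in>?C. fps_X ^ (N - card B) :: rat fps)"
    proof (rule fps_ext)
      fix i
      have "{B \<in> V.active_closed {} N. ?G B \<and> N - card B = i} = {B \<in> ?C. i = N - card B}"
        by auto
      then show "fps_nth (Abs_fps (\<lambda>i. of_nat (card {B \<in> V.active_closed {} N. ?G B \<and> N - card B = i}))) i =
          fps_nth (\<Sum>B\<in>?C. fps_X ^ (N - card B) :: rat fps) i"
        by (simp add: fps_sum_nth sum.If_cases Int_def)
    qed
    then show ?thesis
      by (simp add: hilbert_series_def P dim_cofactor_span_graded[where G = ?G, OF G])
  qed
  also have "\<dots> = (\<Sum>B\<in>?C. fls_X ^ (N - card B))"
  proof -
    have "fps_to_fls (sum g I) = (\<Sum>i\<in>I. fps_to_fls (g i))" for g :: "nat set \<Rightarrow> rat fps" and I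
      by (induction I rule: infinite_finite_induct) simp_all
    then show ?thesis by (simp add: fps_to_fls_power)
  qed
  \<comment> \<open>Laurent series over \<open>rat\<close> form a field, so the interval count
    applies with \<open>x\<close> equal to \<open>fls_X\<close>.\<close>
  also have "\<dots> = (\<Sum>A | A \<subseteq> {..<N} \<and> ?G A. fls_X ^ (N - seq_rank scaleU X A) *
         (1 / fls_X - 1) ^ (card A - seq_rank scaleU X A))"
    unfolding rank
    by (rule V.sum_rank_nullity_eq_sum_active_closed[where G = ?G, OF _ G, symmetric]) simp_all
  also have "\<dots> = (\<Sum>A | A \<subseteq> {..<N} \<and> ?G A. fls_X ^ (N - r) * (fls_X ^ (r - seq_rank scaleU X A) *
         (1 / fls_X - 1) ^ (card A - seq_rank scaleU X A)))"
  proof (rule sum.cong[OF refl])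
    fix A assume "A \<in> {A. A \<subseteq> {..<N} \<and> ?G A}"
    then have A: "A \<subseteq> {..<N}" "finite A" using finite_subset by auto
    have X: "(!) X ` {..<N} = set X"
      using assms(4) by (auto simp: set_conv_nth)
    have r: "r = card (V.lex_basis {..<N})"
      using V.dim_eq_card_lex_basis[of "{..<N}"] assms(2,5) U.dim_span[of "set X"] by (simp add: X)
    \<comment> \<open>Subtraction of exponents is truncated; the bounds
      \<open>seq_rank scaleU X A \<le> r\<close> and \<open>r \<le> N\<close> make the exponent
      split.\<close>
    have "r \<le> N"
      unfolding r using card_mono[OF finite_lessThan V.lex_basis_subset[of "{..<N}"]] by simp
    moreover have "seq_rank scaleU X A \<le> r"
    proof -
      have "U.dim ((!) X ` A) \<le> card ((!) X ` V.lex_basis {..<N})"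
        using assms(5) V.lex_basis_subset[of "{..<N}"] V.lex_basis_properties(1)[of "{..<N}"]
        by (intro U.dim_le_card) (auto simp: X intro: finite_subset)
      also have "\<dots> \<le> r"
        unfolding r using V.lex_basis_subset[of "{..<N}"]
        by (intro card_image_le) (auto intro: finite_subset)
      finally show ?thesis by (simp add: rank)
    qed
    ultimately have "N - seq_rank scaleU X A = (N - r) + (r - seq_rank scaleU X A)" by simp
    then show "fls_X ^ (N - seq_rank scaleU X A) * (1 / fls_X - 1) ^ (card A - seq_rank scaleU X A) =
      fls_X ^ (N - r) * (fls_X ^ (r - seq_rank scaleU X A) *
         (1 / fls_X - 1 :: rat fls) ^ (card A - seq_rank scaleU X A))"
      by (simp only: power_add mult.assoc)
  qed
  finally show ?thesis
    by (simp only: chi sum_distrib_left)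
qed

end
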